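(* Let $(E,w,d)$ be a $\mathbb{V}$-ultra triple such that $E$ is finite, and assume that the map $w$ is constant. Let $\mathcal{F}$ be the Bhargava greedoid of $(E,w,d)$. Let $\mathbb{K}$ be a field such that $\mathcal{F}$ is the Gaussian elimination greedoid of a vector family over $\mathbb{K}$. Then $|\mathbb{K}|\geq\mathrm{mcs}(E,w,d)$.
   Context: $\mathbb{V}$ is a totally ordered abelian group (translation-invariant total order). $E\times_{\neq}E=\{(e,f)\in E\times E: e\neq f\}$. A $\mathbb{V}$-ultra triple is $(E,w,d)$ with $E$ a set, $w:E\to\mathbb{V}$, $d:E\times_{\neq}E\to\mathbb{V}$ with $d(a,b)=d(b,a)$ for distinct $a,b$ and $d(a,b)\le\max\{d(a,c),d(b,c)\}$ for distinct $a,b,c$. $\mathrm{PER}(A)=\sum_{a\in A}w(a)+\sum_{\{a,b\}\subseteq A,\ a\neq b}d(a,b)$ for finite $A\subseteq E$ (unordered pairs). For finite $E$ the Bhargava greedoid is $\{A\subseteq E:\ \mathrm{PER}(A)\ge\mathrm{PER}(B)\ \forall B\subseteq E,\ |B|=|A|\}$. An $\alpha$-clique ($\alpha\in\mathbb{V}$) is $F\subseteq E$ with $d(a,b)=\alpha$ for all distinct $a,b\in F$; a clique is an $\alpha$-clique for some $\alpha$; $\mathrm{mcs}(E,w,d)$ is the maximum size of a clique. Gaussian elimination greedoid of a vector family $(v_e)_{e\in E}$, $v_e\in\mathbb{K}^m$, $m\ge|E|$: $\{F\subseteq E:\ (\pi_{|F|}(v_e))_{e\in F}\text{ linearly independent}\}$,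 where $\pi_k:\mathbb{K}^m\to\mathbb{K}^k$ keeps the first $k$ coordinates. *)

theory Defs
  imports "Jordan_Normal_Form.Matrix" "HOL-Library.Equipollence"
begin

text \<open>
  The distance \<open>d\<close> is only meaningful on pairs of distinct elements of \<open>E\<close>; as HOL functions
  are total, its other values are left unconstrained and are never used below. The same holds
  for the values of \<open>w\<close> outside \<open>E\<close>.
\<close>

definition ultra_triple ::
  "'e set \<Rightarrow> ('e \<Rightarrow> 'v::linordered_ab_group_add) \<Rightarrow> ('e \<Rightarrow> 'e \<Rightarrow> 'v) \<Rightarrow> bool" where
  "ultra_triple E w d \<longleftrightarrow>
     (\<forall>a\<in>E. \<forall>b\<in>E. a \<noteq> b \<longrightarrow> d a b = d b a) \<and>
     (\<forall>a\<in>E. \<forall>b\<in>E. \<forall>c\<in>E. a \<noteq> b \<and> a \<noteq> c \<and> b \<noteq> c \<longrightarrow> d a b \<le> max (d a c) (d b c))"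

text \<open>
  The value of a symmetric \<open>d\<close> on an unordered pair; \<open>dist_on_pair_eq\<close> below shows that it
  does not depend on how the pair is written.
\<close>

definition dist_on_pair :: "('e \<Rightarrow> 'e \<Rightarrow> 'v) \<Rightarrow> 'e set \<Rightarrow> 'v" where
  "dist_on_pair d p = (THE x. \<exists>a b. a \<noteq> b \<and> p = {a, b} \<and> x = d a b)"

lemma dist_on_pair_eq:
  assumes "a \<noteq> b" and "d a b = d b a"
  shows "dist_on_pair d {a, b} = d a b"
proof -
  have "\<exists>a' b'. a' \<noteq> b' \<and> {a, b} = {a', b'} \<and> d a b = d a' b'"
    using assms by blast
  then show ?thesis
    unfolding dist_on_pair_def using assms by (intro the_equality) (auto simp: doubleton_eq_iff)
qed

definition perimeter ::
  "('e \<Rightarrow> 'v::linordered_ab_group_add) \<Rightarrow> ('e \<Rightarrow> 'e \<Rightarrow> 'v) \<Rightarrow> 'e set \<Rightarrow> 'v" where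
  "perimeter w d A =
     (\<Sum>a\<in>A. w a) + (\<Sum>p\<in>{p. p \<subseteq> A \<and> card p = 2}. dist_on_pair d p)"

definition bhargava_greedoid ::
  "'e set \<Rightarrow> ('e \<Rightarrow> 'v::linordered_ab_group_add) \<Rightarrow> ('e \<Rightarrow> 'e \<Rightarrow> 'v) \<Rightarrow> 'e set set" where
  "bhargava_greedoid E w d =
     {A. A \<subseteq> E \<and> (\<forall>B. B \<subseteq> E \<and> card B = card A \<longrightarrow> perimeter w d A \<ge> perimeter w d B)}"

definition alpha_clique :: "'e set \<Rightarrow> ('e \<Rightarrow> 'e \<Rightarrow> 'v) \<Rightarrow> 'v \<Rightarrow> 'e set \<Rightarrow> bool" where
  "alpha_clique E d \<alpha> F \<longleftrightarrow> F \<subseteq> E \<and> (\<forall>a\<in>F. \<forall>b\<in>F. a \<noteq> b \<longrightarrow> d a b = \<alpha>)"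

definition clique :: "'e set \<Rightarrow> ('e \<Rightarrow> 'e \<Rightarrow> 'v) \<Rightarrow> 'e set \<Rightarrow> bool" where
  "clique E d F \<longleftrightarrow> (\<exists>\<alpha>. alpha_clique E d \<alpha> F)"

text \<open>
  For finite \<open>E\<close>, the maximum is over a finite set, which is nonempty because the empty set is
  a clique. The weights \<open>w\<close> play no role.
\<close>

definition mcs ::
  "'e set \<Rightarrow> ('e \<Rightarrow> 'v::linordered_ab_group_add) \<Rightarrow> ('e \<Rightarrow> 'e \<Rightarrow> 'v) \<Rightarrow> nat" where
  "mcs E w d = Max (card ` {F. clique E d F})"

text \<open>
  Linear independence of the family \<open>(u e)\<close>, \<open>e \<in> F\<close>, of vectors of dimension \<open>n\<close>, for finite
  \<open>F\<close>. As this concerns a family rather than a set of vectors, repeated vectors are dependent.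
\<close>

definition lin_indep_family :: "nat \<Rightarrow> ('e \<Rightarrow> 'k::field vec) \<Rightarrow> 'e set \<Rightarrow> bool" where
  "lin_indep_family n u F \<longleftrightarrow>
     (\<forall>c :: 'e \<Rightarrow> 'k. finsum_vec TYPE('k) n (\<lambda>e. c e \<cdot>\<^sub>v u e) F = 0\<^sub>v n \<longrightarrow> (\<forall>e\<in>F. c e = 0))"

text \<open>The projection onto the first \<open>k\<close> coordinates is \<open>\<lambda>x. vec_first x k\<close>.\<close>

definition gaussian_elimination_greedoid :: "'e set \<Rightarrow> ('e \<Rightarrow> 'k::field vec) \<Rightarrow> 'e set set" where
  "gaussian_elimination_greedoid E v =
     {F. F \<subseteq> E \<and> lin_indep_family (card F) (\<lambda>e. vec_first (v e) (card F)) F}"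

end

theory Submission imports Defs begin

text \<open>
  Let \<open>C\<close> be an \<open>\<alpha>\<close>-clique with at least two elements, \<open>B\<close> the closed ball of radius \<open>\<alpha>\<close>
  around it, and \<open>P\<close> a smallest set of the greedoid meeting \<open>B\<close> in at least two elements.
  Gaussian elimination greedoids are accessible, so \<open>P = A \<union> {x, y}\<close> with \<open>A\<close> disjoint from \<open>B\<close>,
  \<open>x, y \<in> B\<close>, and \<open>A \<union> {x}\<close> in the greedoid. All points of \<open>B\<close> are equidistant from each given
  point outside \<open>B\<close>, and \<open>d x y \<le> \<alpha>\<close>, so the exchanged sets \<open>A \<union> {c}\<close> and \<open>A \<union> {c, c'}\<close> with
  \<open>c, c' \<in> C\<close> have maximal perimeter too. Put \<open>k = card A\<close> and fix \<open>c\<^sub>0 \<in> C\<close>. Modulo the span of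
  \<open>A\<close>, the first \<open>k + 1\<close> coordinates of each \<open>v c\<close> can be rescaled to agree with those of \<open>v c\<^sub>0\<close>;
  the difference in coordinate \<open>k + 2\<close> then distinguishes the elements of \<open>C\<close>.
\<close>

section \<open>Independence of truncated vectors\<close>

text \<open>Truncation is a bound on the coordinate index instead of a change of dimension, so the
  same family \<open>u\<close> serves for every number of coordinates.\<close>

definition indep_coords :: "nat \<Rightarrow> ('e \<Rightarrow> nat \<Rightarrow> 'k::field) \<Rightarrow> 'e set \<Rightarrow> bool" where
  "indep_coords n u F \<longleftrightarrow>
     (\<forall>c. (\<forall>i<n. (\<Sum>e\<in>F. c e * u e i) = 0) \<longrightarrow> (\<forall>e\<in>F. c e = 0))"

lemma indep_coordsD:
  assumes "indep_coords n u F" and "\<And>i. i < n \<Longrightarrow> (\<Sum>e\<in>F. c e * u e i) = 0" and "e \<in> F"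
  shows "c e = 0"
  using assms unfolding indep_coords_def by blast

lemma lin_indep_family_vec_first:
  fixes v :: "'e \<Rightarrow> 'k::field vec"
  assumes "finite F"
  shows "lin_indep_family n (\<lambda>e. vec_first (v e) n) F \<longleftrightarrow> indep_coords n (\<lambda>e i. v e $ i) F"
proof -
  have "finsum_vec TYPE('k) n (\<lambda>e. c e \<cdot>\<^sub>v vec_first (v e) n) F = 0\<^sub>v n \<longleftrightarrow>
      (\<forall>i<n. (\<Sum>e\<in>F. c e * v e $ i) = 0)" for c
  proof -
    let ?s = "finsum_vec TYPE('k) n (\<lambda>e. c e \<cdot>\<^sub>v vec_first (v e) n) F"
    have "?s \<in> carrier_vec n"
      by (rule finsum_vec_closed) auto
    moreover have "?s $ i = (\<Sum>e\<in>F. c e * v e $ i)" if "i < n" for i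
      using assms that by (subst index_finsum_vec) (auto simp: vec_first_def)
    ultimately show ?thesis
      by (auto simp: vec_eq_iff)
  qed
  then show ?thesis
    unfolding lin_indep_family_def indep_coords_def by simp
qed

lemma gaussian_elimination_greedoid_iff:
  assumes "finite E"
  shows "F \<in> gaussian_elimination_greedoid E v \<longleftrightarrow>
    F \<subseteq> E \<and> indep_coords (card F) (\<lambda>e i. v e $ i) F"
  unfolding gaussian_elimination_greedoid_def
  using lin_indep_family_vec_first finite_subset[OF _ assms] by blast

text \<open>Gaussian elimination: unless coordinate \<open>n\<close> vanishes throughout, a pivot
  \<open>p\<close> clears it from the other vectors, of which more than \<open>n\<close> remain for
  the induction hypothesis.\<close>

lemma exists_dependence:
  fixes u :: "'e \<Rightarrow> nat \<Rightarrow> 'k::field"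
  assumes "finite F" and "n < card F"
  shows "\<exists>c. (\<exists>e\<in>F. c e \<noteq> 0) \<and> (\<forall>i<n. (\<Sum>e\<in>F. c e * u e i) = 0)"
  using assms
proof (induction n arbitrary: F u)
  case 0
  then have "F \<noteq> {}" by auto
  then show ?case by (intro exI[of _ "\<lambda>_. 1"]) auto
next
  case (Suc n)
  show ?case
  proof (cases "\<forall>e\<in>F. u e n = 0")
    case True
    obtain c where "\<exists>e\<in>F. c e \<noteq> 0" and "\<forall>i<n. (\<Sum>e\<in>F. c e * u e i) = 0"
      using Suc.IH[of F u] Suc.prems by auto
    then show ?thesis
      using True by (intro exI[of _ c]) (auto simp: less_Suc_eq)
  next
    case False
    then obtain p where p: "p \<in> F" "u p n \<noteq> 0" by blast
    let ?G = "F - {p}" and ?u = "\<lambda>e i. u e i - u e n / u p n * u p i"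
    have "n < card ?G" using p Suc.prems by simp
    then obtain c where c: "\<exists>e\<in>?G. c e \<noteq> 0" "\<forall>i<n. (\<Sum>e\<in>?G. c e * ?u e i) = 0"
      using Suc.IH[of ?G ?u] Suc.prems(1) by auto
    \<comment> \<open>The coefficient at \<open>p\<close> collects the multiples of
      \<open>u p\<close> subtracted in \<open>?u\<close>, so both sums in \<open>eq\<close>
      agree.\<close>
    define q where "q = - (\<Sum>e\<in>?G. c e * u e n) / u p n"
    let ?c = "c(p := q)"
    have eq: "(\<Sum>e\<in>F. ?c e * u e i) = (\<Sum>e\<in>?G. c e * ?u e i)" for i
    proof -
      have "(\<Sum>e\<in>F. ?c e * u e i) = q * u p i + (\<Sum>e\<in>?G. ?c e * u e i)"
        using p Suc.prems(1) by (simp add: sum.remove)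
      also have "(\<Sum>e\<in>?G. ?c e * u e i) = (\<Sum>e\<in>?G. c e * u e i)"
        by (rule sum.cong) auto
      also have "q * u p i = - (\<Sum>e\<in>?G. c e * (u e n / u p n * u p i))"
        unfolding q_def by (simp add: sum_distrib_right sum_divide_distrib mult.assoc)
      finally show ?thesis
        by (simp add: right_diff_distrib sum_subtractf)
    qed
    have "(\<Sum>e\<in>F. ?c e * u e i) = 0" if "i < Suc n" for i
      using that c(2) p(2) unfolding eq by (cases "i = n") auto
    moreover have "\<exists>e\<in>F. ?c e \<noteq> 0"
      using c(1) by auto
    ultimately show ?thesis by blast
  qed
qed

text \<open>
  A dependence of the vectors in the first \<open>n\<close> coordinates is unique up to scaling, because the
  last coordinate of a suitable combination of two dependences vanishes as well.
\<close>

lemma indep_coords_remove: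
  fixes u :: "'e \<Rightarrow> nat \<Rightarrow> 'k::field"
  assumes "finite F" and card: "card F = Suc n" and ind: "indep_coords (Suc n) u F"
  shows "\<exists>e\<in>F. indep_coords n u (F - {e})"
proof -
  obtain c p where p: "p \<in> F" "c p \<noteq> 0" and c: "\<forall>i<n. (\<Sum>e\<in>F. c e * u e i) = 0"
    using exists_dependence[of F n u] assms by auto
  define t where "t = (\<Sum>e\<in>F. c e * u e n)"
  have t: "t \<noteq> 0"
  proof
    assume "t = 0"
    then have "(\<Sum>e\<in>F. c e * u e i) = 0" if "i < Suc n" for i
      using c that unfolding t_def by (auto simp: less_Suc_eq)
    then show False
      using indep_coordsD[OF ind, of c p] p by blast
  qed
  have "\<forall>e\<in>F - {p}. b e = 0" if b: "\<forall>i<n. (\<Sum>e\<in>F - {p}. b e * u e i) = 0" for b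
  proof -
    let ?b = "b(p := 0)"
    have b': "(\<Sum>e\<in>F. ?b e * u e i) = (\<Sum>e\<in>F - {p}. b e * u e i)" for i
    proof -
      have "(\<Sum>e\<in>F. ?b e * u e i) = (\<Sum>e\<in>F - {p}. ?b e * u e i)"
        using p(1) assms(1) by (simp add: sum.remove)
      also have "\<dots> = (\<Sum>e\<in>F - {p}. b e * u e i)"
        by (rule sum.cong) auto
      finally show ?thesis .
    qed
    define s where "s = (\<Sum>e\<in>F. ?b e * u e n)"
    \<comment> \<open>The factors \<open>t\<close> and \<open>s\<close> make coordinate
      \<open>n\<close> cancel as \<open>t * s - s * t\<close>, so independence in all
      \<open>Suc n\<close> coordinates applies.\<close>
    let ?g = "\<lambda>e. t * ?b e - s * c e"
    have lin: "(\<Sum>e\<in>F. ?g e * u e i) = t * (\<Sum>e\<in>F. ?b e * u e i) - s * (\<Sum>e\<in>F. c e * u e i)" for i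
      by (simp only: left_diff_distrib sum_subtractf sum_distrib_left mult.assoc)
    have "(\<Sum>e\<in>F. ?g e * u e i) = 0" if "i < Suc n" for i
    proof (cases "i = n")
      case True
      then show ?thesis using lin[of n] by (simp only: s_def[symmetric] t_def[symmetric]) simp
    next
      case False
      then have "i < n" using that by simp
      then show ?thesis using lin[of i] b c by (simp only: b') simp
    qed
    then have g: "?g e = 0" if "e \<in> F" for e
      using indep_coordsD[OF ind, of ?g] that by blast
    \<comment> \<open>At \<open>p\<close> the value of \<open>?b\<close> is 0, which leaves only
      \<open>- s * c p\<close>.\<close>
    have "s = 0" using g[OF p(1)] p(2) by simp
    show ?thesis
    proof
      fix e assume "e \<in> F - {p}"
      then show "b e = 0" using g[of e] \<open>s = 0\<close> t by simp
    qed
  qed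
  then show ?thesis
    using p(1) unfolding indep_coords_def by blast
qed

lemma gaussian_elimination_greedoid_accessible:
  assumes "finite E" and F: "F \<in> gaussian_elimination_greedoid E v" and "F \<noteq> {}"
  shows "\<exists>e\<in>F. F - {e} \<in> gaussian_elimination_greedoid E v"
proof -
  have sub: "F \<subseteq> E" and ind: "indep_coords (card F) (\<lambda>e i. v e $ i) F"
    using F gaussian_elimination_greedoid_iff[OF assms(1)] by blast+
  have fin: "finite F" using sub assms(1) finite_subset by blast
  then obtain n where n: "card F = Suc n"
    using assms(3) by (cases "card F") auto
  then obtain e where "e \<in> F" "indep_coords n (\<lambda>e i. v e $ i) (F - {e})"
    using indep_coords_remove[OF fin n] ind by auto
  then show ?thesis
    using n sub fin by (auto simp: gaussian_elimination_greedoid_iff[OF assms(1)])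
qed

text \<open>
  Coordinates count from 0: the map sends \<open>c\<close> to coordinate \<open>card A + 1\<close> of a combination of
  \<open>u c\<close> and \<open>A\<close> that agrees with \<open>u c\<^sub>0\<close> in all earlier coordinates.
\<close>

lemma inj_on_of_indep_extensions:
  fixes u :: "'e \<Rightarrow> nat \<Rightarrow> 'k::field"
  assumes A: "finite A" "A \<inter> C = {}"
    and one: "\<And>c. c \<in> C \<Longrightarrow> indep_coords (card A + 1) u (insert c A)"
    and two: "\<And>c c'. c \<in> C \<Longrightarrow> c' \<in> C \<Longrightarrow> c \<noteq> c' \<Longrightarrow>
      indep_coords (card A + 2) u (insert c (insert c' A))"
  shows "\<exists>f :: 'e \<Rightarrow> 'k. inj_on f C"
proof (cases "C = {}")
  case True
  then show ?thesis by simp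
next
  case False
  then obtain c0 where c0: "c0 \<in> C" by blast
  define n where "n = card A + 1"
  have "\<exists>l b. \<forall>i<n. l * u c i + (\<Sum>a\<in>A. b a * u a i) = u c0 i" if c: "c \<in> C" for c
  proof (cases "c = c0")
    case True
    then show ?thesis by (intro exI[of _ 1] exI[of _ "\<lambda>_. 0"]) simp
  next
    case False
    let ?F = "insert c0 (insert c A)"
    have notin: "c0 \<notin> A" "c \<notin> A" using A(2) c c0 by auto
    \<comment> \<open>These are \<open>card A + 2\<close> vectors in \<open>card A + 1\<close>
      coordinates. By \<open>one\<close>, the dependence must involve \<open>c0\<close>, so it can
      be solved for \<open>u c0\<close>.\<close>
    have "n < card ?F" using A(1) notin False by (simp add: n_def)
    then obtain g where g: "\<exists>e\<in>?F. g e \<noteq> 0" "\<forall>i<n. (\<Sum>e\<in>?F. g e * u e i) = 0"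
      using exists_dependence[of ?F n u] A(1) by auto
    have expand: "(\<Sum>e\<in>?F. g e * u e i) = g c0 * u c0 i + (\<Sum>e\<in>insert c A. g e * u e i)" for i
      using A(1) notin False by simp
    have g0: "g c0 \<noteq> 0"
    proof
      assume "g c0 = 0"
      then have "\<forall>i<n. (\<Sum>e\<in>insert c A. g e * u e i) = 0"
        using g(2) unfolding expand by simp
      then have "\<forall>e\<in>insert c A. g e = 0"
        using one[OF c] unfolding n_def indep_coords_def by blast
      then show False using g(1) \<open>g c0 = 0\<close> by auto
    qed
    let ?l = "- g c / g c0" and ?b = "\<lambda>a. - g a / g c0"
    have "?l * u c i + (\<Sum>a\<in>A. ?b a * u a i) = u c0 i" if "i < n" for i
    proof -
      have "g c * u c i + (\<Sum>a\<in>A. g a * u a i) = - g c0 * u c0 i"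
        using g(2) that A(1) notin(2) unfolding expand
        by (simp add: eq_neg_iff_add_eq_0 add.commute)
      moreover have "?l * u c i + (\<Sum>a\<in>A. ?b a * u a i) =
          - (g c * u c i + (\<Sum>a\<in>A. g a * u a i)) / g c0"
        by (simp add: sum_divide_distrib sum_negf add_divide_distrib diff_divide_distrib)
      ultimately show ?thesis using g0 by simp
    qed
    then show ?thesis by (intro exI[of _ ?l] exI[of _ ?b]) blast
  qed
  then obtain l b where lb:
    "\<And>c i. c \<in> C \<Longrightarrow> i < n \<Longrightarrow> l c * u c i + (\<Sum>a\<in>A. b c a * u a i) = u c0 i"
    by metis
  define f where "f c = l c * u c n + (\<Sum>a\<in>A. b c a * u a n)" for c
  have "inj_on f C"
  proof (rule inj_onI, rule ccontr)
    fix c c' assume c: "c \<in> C" "c' \<in> C" "f c = f c'" "c \<noteq> c'"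
    have notin: "c0 \<notin> A" "c \<notin> A" "c' \<notin> A" using A(2) c c0 by auto
    let ?F = "insert c (insert c' A)"
    \<comment> \<open>The difference of the combinations for \<open>c\<close> and \<open>c'\<close>:
      below coordinate \<open>n\<close> both give \<open>u c0\<close>, and in coordinate
      \<open>n\<close> they agree because \<open>f c = f c'\<close>.\<close>
    define g where "g e = (if e = c then l c else if e = c' then - l c' else b c e - b c' e)" for e
    have "(\<Sum>e\<in>?F. g e * u e i) = 0" if i: "i < card A + 2" for i
    proof -
      have "(\<Sum>a\<in>A. g a * u a i) = (\<Sum>a\<in>A. b c a * u a i - b c' a * u a i)"
        by (rule sum.cong) (use notin in \<open>auto simp: g_def left_diff_distrib\<close>)
      then have "(\<Sum>e\<in>?F. g e * u e i) = (l c * u c i + (\<Sum>a\<in>A. b c a * u a i)) -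
          (l c' * u c' i + (\<Sum>a\<in>A. b c' a * u a i))"
        using A(1) notin c(4) by (simp add: g_def sum_subtractf)
      also have "\<dots> = 0"
      proof (cases "i = n")
        case True
        then show ?thesis using c(3) by (simp add: f_def)
      next
        case False
        then have "i < n" using i by (simp add: n_def)
        then show ?thesis using lb c(1,2) by simp
      qed
      finally show ?thesis .
    qed
    then have "g c = 0"
      using indep_coordsD[OF two[OF c(1,2,4)], of g c] by blast
    then have l0: "l c = 0" by (simp add: g_def)
    \<comment> \<open>With \<open>l c = 0\<close>, the first \<open>n\<close> coordinates of
      \<open>u c0\<close> come from \<open>A\<close> alone, contradicting \<open>one\<close> at
      \<open>c0\<close>. This covers \<open>c = c0\<close> too.\<close>
    define h where "h e = (if e = c0 then - 1 else b c e)" for e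
    have "(\<Sum>e\<in>insert c0 A. h e * u e i) = 0" if "i < card A + 1" for i
    proof -
      have "(\<Sum>a\<in>A. h a * u a i) = (\<Sum>a\<in>A. b c a * u a i)"
        by (rule sum.cong) (use notin in \<open>auto simp: h_def\<close>)
      then show ?thesis
        using lb[OF c(1), of i] that l0 A(1) notin(1) by (simp add: n_def h_def)
    qed
    then have "h c0 = 0"
      using indep_coordsD[OF one[OF c0], of h c0] by blast
    then show False by (simp add: h_def)
  qed
  then show ?thesis by blast
qed

section \<open>Perimeters and exchange in a ball\<close>

lemma perimeter_insert:
  assumes "ultra_triple E w d" and "finite A" and "insert x A \<subseteq> E" and "x \<notin> A"
  shows "perimeter w d (insert x A) = perimeter w d A + w x + (\<Sum>a\<in>A. d x a)"
proof -
  let ?P = "\<lambda>A. {p. p \<subseteq> A \<and> card p = 2}"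
  have "?P (insert x A) = ?P A \<union> (\<lambda>a. {x, a}) ` A"
  proof (intro equalityI subsetI)
    fix p assume "p \<in> ?P (insert x A)"
    then obtain a b where "p = {a, b}" "a \<noteq> b" "p \<subseteq> insert x A"
      by (auto simp: card_2_iff)
    then show "p \<in> ?P A \<union> (\<lambda>a. {x, a}) ` A"
      by (auto simp: doubleton_eq_iff)
  qed (use assms(4) in \<open>auto simp: card_2_iff\<close>)
  moreover have "finite (?P A)"
    by (rule finite_subset[of _ "Pow A"]) (use assms(2) in auto)
  moreover have "?P A \<inter> (\<lambda>a. {x, a}) ` A = {}"
    using assms(4) by auto
  moreover have "inj_on (\<lambda>a. {x, a}) A"
    by (auto simp: inj_on_def doubleton_eq_iff)
  moreover have "dist_on_pair d {x, a} = d x a" if "a \<in> A" for a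
  proof (rule dist_on_pair_eq)
    show "x \<noteq> a" using that assms(4) by auto
    then show "d x a = d a x"
      using that assms(1,3) unfolding ultra_triple_def by auto
  qed
  ultimately show ?thesis
    using assms(2,4) unfolding perimeter_def
    by (simp add: sum.union_disjoint sum.reindex algebra_simps)
qed

lemma bhargava_greedoid_exchange:
  assumes "F \<in> bhargava_greedoid E w d" and "G \<subseteq> E" and "card G = card F"
    and "perimeter w d F \<le> perimeter w d G"
  shows "G \<in> bhargava_greedoid E w d"
  using assms unfolding bhargava_greedoid_def by (auto intro: order_trans)

text \<open>Each point of \<open>B\<close> adds the same amount to the perimeter of
  \<open>A\<close>, and two points add twice that plus their distance. Distinct points of
  \<open>C\<close> realise the largest possible distance \<alpha>, so moving to them loses
  nothing.\<close>

lemma ball_exchange: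
  assumes ut: "ultra_triple E w d" and fin: "finite E" and const: "\<forall>e\<in>E. w e = r"
    and clq: "alpha_clique E d \<alpha> C" and c0: "c0 \<in> C"
    and B_def: "B = {x \<in> E. x = c0 \<or> d x c0 \<le> \<alpha>}"
    and A: "A \<subseteq> E - B" and xy: "x \<in> B" "y \<in> B" "x \<noteq> y"
    and F1: "insert x A \<in> bhargava_greedoid E w d"
    and F2: "insert x (insert y A) \<in> bhargava_greedoid E w d"
  shows "c \<in> C \<Longrightarrow> insert c A \<in> bhargava_greedoid E w d"
    and "c \<in> C \<Longrightarrow> c' \<in> C \<Longrightarrow> c \<noteq> c' \<Longrightarrow> insert c (insert c' A) \<in> bhargava_greedoid E w d"
proof -
  have sym: "d a b = d b a" if "a \<in> E" "b \<in> E" "a \<noteq> b" for a b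
    using ut that unfolding ultra_triple_def by blast
  have ultra: "d a b \<le> max (d a c) (d b c)"
    if "a \<in> E" "b \<in> E" "c \<in> E" "a \<noteq> b" "a \<noteq> c" "b \<noteq> c" for a b c
    using ut that unfolding ultra_triple_def by blast
  have CE: "C \<subseteq> E" and C\<alpha>: "\<And>a b. a \<in> C \<Longrightarrow> b \<in> C \<Longrightarrow> a \<noteq> b \<Longrightarrow> d a b = \<alpha>"
    using clq unfolding alpha_clique_def by auto
  have CB: "C \<subseteq> B" using CE C\<alpha> c0 unfolding B_def by fastforce
  have BE: "B \<subseteq> E" unfolding B_def by auto
  have c0B: "c0 \<in> B" and c0E: "c0 \<in> E" using CB c0 BE by auto
  have finA: "finite A" using A fin finite_subset by blast
  have d_le: "d x y \<le> \<alpha>"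
  proof (cases "x = c0 \<or> y = c0")
    case True
    then show ?thesis using xy sym[of x y] BE unfolding B_def by auto
  next
    case False
    then have "d x c0 \<le> \<alpha>" "d y c0 \<le> \<alpha>" using xy unfolding B_def by auto
    moreover have "d x y \<le> max (d x c0) (d y c0)"
      using ultra[of x y c0] False xy BE c0E by blast
    ultimately show ?thesis by (auto simp: max_def split: if_splits)
  qed
  \<comment> \<open>The two longest sides of an ultrametric triangle are equal, and here
    \<open>d z c0 \<le> \<alpha> < d a c0\<close>.\<close>
  have outside: "d z a = d c0 a" if z: "z \<in> B" and a: "a \<in> A" for z a
  proof (cases "z = c0")
    case False
    have aE: "a \<in> E" and aB: "a \<notin> B" and zE: "z \<in> E" using a A z BE by auto
    then have ne: "a \<noteq> z" "a \<noteq> c0" using z c0B by auto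
    have "\<alpha> < d a c0" using aE aB ne unfolding B_def by auto
    moreover have "d z c0 \<le> \<alpha>" using z False unfolding B_def by auto
    moreover have "d z a \<le> max (d z c0) (d a c0)" "d a c0 \<le> max (d a z) (d c0 z)"
      using ultra[of z a c0] ultra[of a c0 z] aE zE c0E ne False by auto
    ultimately show ?thesis
      using sym[of a z] sym[of c0 z] sym[of a c0] aE zE c0E ne False by (auto simp: max_def split: if_splits)
  qed simp
  define s where "s = r + (\<Sum>a\<in>A. d c0 a)"
  have ins: "perimeter w d (insert z A) = perimeter w d A + s" if z: "z \<in> B" for z
  proof -
    have "(\<Sum>a\<in>A. d z a) = (\<Sum>a\<in>A. d c0 a)"
      by (rule sum.cong) (use outside z in auto)
    then show ?thesis
      using perimeter_insert[OF ut finA, of z] z A BE const unfolding s_def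
      by (auto simp: add.assoc)
  qed
  have ins2: "perimeter w d (insert z (insert z' A)) = perimeter w d A + s + s + d z z'"
    if z: "z \<in> B" "z' \<in> B" "z \<noteq> z'" for z z'
  proof -
    have "z' \<notin> A" using z A by auto
    moreover have "(\<Sum>a\<in>A. d z a) = (\<Sum>a\<in>A. d c0 a)"
      by (rule sum.cong) (use outside z in auto)
    ultimately have "(\<Sum>a\<in>insert z' A. d z a) = d z z' + (\<Sum>a\<in>A. d c0 a)"
      using finA by simp
    moreover have "perimeter w d (insert z (insert z' A)) =
        perimeter w d (insert z' A) + w z + (\<Sum>a\<in>insert z' A. d z a)"
      using z A BE finA by (intro perimeter_insert[OF ut]) auto
    moreover have "w z = r" using const z BE by auto
    ultimately show ?thesis
      using ins[OF z(2)] unfolding s_def by (simp add: algebra_simps)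
  qed
  show "insert c A \<in> bhargava_greedoid E w d" if "c \<in> C" for c
  proof (rule bhargava_greedoid_exchange[OF F1])
    have c: "c \<in> B" "c \<notin> A" "x \<notin> A" using that CB A xy by auto
    then show "insert c A \<subseteq> E" "card (insert c A) = card (insert x A)"
      using A BE finA by auto
    show "perimeter w d (insert x A) \<le> perimeter w d (insert c A)"
      using ins c xy by simp
  qed
  show "insert c (insert c' A) \<in> bhargava_greedoid E w d"
    if "c \<in> C" "c' \<in> C" "c \<noteq> c'" for c c'
  proof (rule bhargava_greedoid_exchange[OF F2])
    have c: "c \<in> B" "c' \<in> B" "c \<notin> A" "c' \<notin> A" "x \<notin> A" "y \<notin> A" using that CB A xy by auto
    then show "insert c (insert c' A) \<subseteq> E"
      "card (insert c (insert c' A)) = card (insert x (insert y A))"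
      using A BE finA that(3) xy(3) by auto
    show "perimeter w d (insert x (insert y A)) \<le> perimeter w d (insert c (insert c' A))"
      using ins2[OF xy] ins2[OF c(1,2) that(3)] d_le C\<alpha>[OF that] by simp
  qed
qed

text \<open>Let \<open>P\<close> be a smallest member with at least two elements in
  \<open>B\<close>. Removing the \<open>y\<close> given by \<open>acc\<close> must leave fewer than
  two, so \<open>y\<close> lies in \<open>B\<close> and exactly one other element \<open>x\<close>
  of \<open>P\<close> does. Then \<open>A\<close> is \<open>P - B\<close>.\<close>

lemma accessible_step_into:
  assumes "finite E" and "E \<in> \<F>" and "B \<subseteq> E" and "2 \<le> card B"
    and acc: "\<And>F. F \<in> \<F> \<Longrightarrow> F \<noteq> {} \<Longrightarrow> \<exists>e\<in>F. F - {e} \<in> \<F>"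
    and sub: "\<And>F. F \<in> \<F> \<Longrightarrow> F \<subseteq> E"
  obtains A x y where "A \<subseteq> E - B" "x \<in> B" "y \<in> B" "x \<noteq> y"
    "insert x A \<in> \<F>" "insert x (insert y A) \<in> \<F>"
proof -
  let ?Q = "\<lambda>P. P \<in> \<F> \<and> 2 \<le> card (P \<inter> B)"
  have "?Q E" using assms(2-4) by (simp add: Int_absorb1)
  then obtain P where P: "?Q P" and min: "\<And>P'. ?Q P' \<Longrightarrow> card P \<le> card P'"
    using ex_has_least_nat[of ?Q E card] by blast
  have finP: "finite P" using P sub assms(1) finite_subset by blast
  have "P \<noteq> {}" using P by auto
  then obtain y where y: "y \<in> P" "P - {y} \<in> \<F>" using acc P by blast
  have "\<not> ?Q (P - {y})"
    using min[of "P - {y}"] card_Diff1_less[OF finP y(1)] by linarith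
  then have lt: "card (P \<inter> B - {y}) < 2" using y(2) by (simp add: Int_Diff Diff_Int_distrib2 Int_commute)
  have yB: "y \<in> B"
  proof (rule ccontr)
    assume "y \<notin> B"
    then have "P \<inter> B - {y} = P \<inter> B" by auto
    then show False using lt P by simp
  qed
  have "card (P \<inter> B - {y}) = 1"
    using lt P y(1) yB finP by (simp add: card_Diff_singleton) linarith
  then obtain x where x: "P \<inter> B - {y} = {x}" by (auto simp: card_1_singleton_iff)
  have "insert x (P - B) = P - {y}" "insert x (insert y (P - B)) = P" using x y(1) yB by blast+
  moreover have "P - B \<subseteq> E - B" using P sub by blast
  moreover have "x \<in> B" "x \<noteq> y" using x by auto
  ultimately show thesis using that[of "P - B" x y] y P yB by simp
qed

section \<open>Injecting a clique into the field\<close>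

lemma clique_inj_on:
  fixes E :: "'e set" and v :: "'e \<Rightarrow> 'k::field vec"
  assumes ut: "ultra_triple E w d" and fin: "finite E" and const: "\<forall>e\<in>E. w e = r"
    and eq: "bhargava_greedoid E w d = gaussian_elimination_greedoid E v"
    and clq: "clique E d C" and card: "2 \<le> card C"
  shows "\<exists>f :: 'e \<Rightarrow> 'k. inj_on f C"
proof -
  obtain \<alpha> where \<alpha>: "alpha_clique E d \<alpha> C" using clq unfolding clique_def by blast
  obtain c0 where c0: "c0 \<in> C" using card by fastforce
  \<comment> \<open>The centre is listed separately because \<open>d c0 c0\<close> is
    unconstrained.\<close>
  define B where "B = {x \<in> E. x = c0 \<or> d x c0 \<le> \<alpha>}"
  let ?\<F> = "bhargava_greedoid E w d"
  have BE: "B \<subseteq> E" unfolding B_def by auto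
  have CB: "C \<subseteq> B" using \<alpha> c0 unfolding B_def alpha_clique_def by fastforce
  have "2 \<le> card B"
    using card card_mono[OF finite_subset[OF BE fin] CB] by simp
  \<comment> \<open>\<open>E\<close> is its only subset of full cardinality.\<close>
  moreover have "E \<in> ?\<F>"
    using fin unfolding bhargava_greedoid_def by (auto dest: card_subset_eq)
  moreover have "\<And>F. F \<in> ?\<F> \<Longrightarrow> F \<noteq> {} \<Longrightarrow> \<exists>e\<in>F. F - {e} \<in> ?\<F>"
    unfolding eq by (rule gaussian_elimination_greedoid_accessible[OF fin])
  moreover have "\<And>F. F \<in> ?\<F> \<Longrightarrow> F \<subseteq> E"
    unfolding bhargava_greedoid_def by simp
  ultimately obtain A x y where A: "A \<subseteq> E - B" "x \<in> B" "y \<in> B" "x \<noteq> y"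
    "insert x A \<in> ?\<F>" "insert x (insert y A) \<in> ?\<F>"
    using accessible_step_into[OF fin _ BE, of ?\<F>] by blast
  note exch = ball_exchange[OF ut fin const \<alpha> c0 B_def A]
  have finA: "finite A" using A(1) fin finite_subset by blast
  have disj: "A \<inter> C = {}" using A(1) CB by blast
  show ?thesis
  proof (rule inj_on_of_indep_extensions[OF finA disj, where u = "\<lambda>e i. v e $ i"])
    fix c assume c: "c \<in> C"
    then have "c \<notin> A" using disj by blast
    then show "indep_coords (card A + 1) (\<lambda>e i. v e $ i) (insert c A)"
      using exch(1)[OF c] finA unfolding eq gaussian_elimination_greedoid_iff[OF fin]
      by (auto simp: card_insert_if)
    fix c' assume c': "c' \<in> C" "c \<noteq> c'"
    have "c \<notin> A" "c' \<notin> A" using c c' disj by auto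
    then show "indep_coords (card A + 2) (\<lambda>e i. v e $ i) (insert c (insert c' A))"
      using exch(2)[OF c c'] c'(2) finA unfolding eq gaussian_elimination_greedoid_iff[OF fin]
      by (auto simp: card_insert_if)
  qed
qed

text \<open>The bound is stated by an injection because \<open>card\<close> of an infinite field is
  0.\<close>

theorem theorem5p1:
  fixes E :: "'e set"
    and w :: "'e \<Rightarrow> 'v::linordered_ab_group_add"
    and d :: "'e \<Rightarrow> 'e \<Rightarrow> 'v"
    and m :: nat
    and v :: "'e \<Rightarrow> 'k::field vec"
  assumes "ultra_triple E w d"
    and "finite E"
    and "\<exists>c. \<forall>e\<in>E. w e = c"
    and "m \<ge> card E"
    and "\<forall>e\<in>E. v e \<in> carrier_vec m"
    and "bhargava_greedoid E w d = gaussian_elimination_greedoid E v"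
  shows "{..<mcs E w d} \<lesssim> (UNIV :: 'k set)"
proof -
  have fin: "finite {F. clique E d F}"
    by (rule finite_subset[of _ "Pow E"])
      (use assms(2) in \<open>auto simp: clique_def alpha_clique_def\<close>)
  moreover have "clique E d {}"
    by (simp add: clique_def alpha_clique_def)
  ultimately have "mcs E w d \<in> card ` {F. clique E d F}"
    unfolding mcs_def by (intro Max_in) auto
  then obtain C where C: "clique E d C" "card C = mcs E w d" by auto
  have finC: "finite C"
    using C(1) assms(2) finite_subset unfolding clique_def alpha_clique_def by blast
  obtain f :: "'e \<Rightarrow> 'k" where f: "inj_on f C"
  proof (cases "2 \<le> card C")
    case True
    then show ?thesis
      using clique_inj_on[OF assms(1,2) _ assms(6) C(1)] assms(3) that by blast
  next
    case False
    then have "card C \<le> Suc 0" by simp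
    \<comment> \<open>With at most one element in \<open>C\<close>, a constant map is
      injective.\<close>
    then have "inj_on (\<lambda>_. 0 :: 'k) C"
      using card_le_Suc0_iff_eq[OF finC] unfolding inj_on_def by blast
    then show ?thesis using that by blast
  qed
  obtain g where "bij_betw g {..<mcs E w d} C"
    using ex_bij_betw_nat_finite[OF finC] C(2) by (auto simp: lessThan_atLeast0)
  then have "inj_on (f \<circ> g) {..<mcs E w d}"
    using f by (auto simp: bij_betw_def intro: comp_inj_on)
  then show ?thesis
    unfolding lepoll_def by blast
qed

end
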